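(* Let $\mathcal{B}$ be either $W^{1,1}(\mathbb{R})$ or $L^1(\mathbb{R})\cap C^0(\mathbb{R})$, and let $f_0$ be a spectrally stable homogeneous equilibrium of the Vlasov–Poisson system with $f_0'\in\mathcal{B}$. Then $f_0$ is structurally unstable with respect to homogeneous perturbations of the equilibrium measured in $\mathcal{B}$. That is, for every $\epsilon>0$ there exists a homogeneous perturbation $\delta f_0=\delta f_0(p)$ with $\|\delta f_0'\|_{\mathcal{B}}<\epsilon$, and hence $\|\delta\mathfrak{T}_k\|<\epsilon/|k|$ for every wavenumber $k$, such that the perturbed equilibrium $f_0+\delta f_0$ is spectrally unstable.
   Context: For a homogeneous (spatially independent) equilibrium $f_0(p)$ of the one-dimensional Vlasov–Poisson system, the linearization for a Fourier mode with wavenumber $k\neq 0$ is $$\partial_t\zeta_k=-ikp\,\zeta_k+\frac{i f_0'(p)}{k}\int_{\mathbb{R}}\zeta_k(\bar p,t)\,d\bar p=:-\mathfrak{T}_k\zeta_k,$$ with $\zeta_k(\cdot,t)$ in a Banach space $\mathcal{B}$ of functions of $p\in\mathbb{R}$. Spectral stability. The equilibrium $f_0$ is spectrally stable if, for every admissible wavenumber $k\neq0$, the spectrum of $\mathfrak{T}_k$ lies on the imaginary axis. Equivalently, for every such $k$, the dispersion relation $$\varepsilon(k,u)=1+\frac{1}{k^2}\int_{\mathbb{R}}\frac{f_0'(p)}{u-p}\,dp=0$$ has no root $u$ with $\operatorname{Im}u>0$. Otherwise $f_0$ is spectrally unstable. Perturbations. A perturbation of the equilibrium $f_0\mapsto f_0+\delta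 f_0$ changes the evolution operator by $$\delta\mathfrak{T}_k\zeta=-\frac{i\,\delta f_0'}{k}\int_{\mathbb{R}}\zeta\,d\bar p,$$ and its size is measured by the operator norm on $\mathcal{B}$. In $W^{1,1}$ and $C^n\cap L^1$ this norm satisfies $\|\delta\mathfrak{T}_k\|\le\|\delta f_0'/k\|_{\mathcal{B}}$. Structural stability. A spectrally stable $f_0$ is structurally stable (with respect to a given class of perturbations) if there is $\epsilon>0$ such that every perturbation in the class with $\|\delta f_0'\|_{\mathcal{B}}<\epsilon$ leaves the system spectrally stable. Otherwise it is structurally unstable. *)

theory Defs
  imports "HOL-Analysis.Analysis"
begin

definition test_function :: "(real \<Rightarrow> real) \<Rightarrow> bool" where
  "test_function \<phi> \<longleftrightarrow>
     (\<forall>n x. ((deriv ^^ n) \<phi>) differentiable (at x)) \<and>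
     (\<exists>R. \<forall>x. R < \<bar>x\<bar> \<longrightarrow> \<phi> x = 0)"

definition weak_deriv :: "(real \<Rightarrow> real) \<Rightarrow> (real \<Rightarrow> real) \<Rightarrow> bool" where
  "weak_deriv g h \<longleftrightarrow> integrable lborel h \<and>
     (\<forall>\<phi>. test_function \<phi> \<longrightarrow>
        (LINT x|lborel. g x * deriv \<phi> x) = - (LINT x|lborel. h x * \<phi> x))"

datatype space = W11 | L1C0

fun in_space :: "space \<Rightarrow> (real \<Rightarrow> real) \<Rightarrow> bool" where
  "in_space W11 g \<longleftrightarrow> integrable lborel g \<and> (\<exists>h. weak_deriv g h)"
| "in_space L1C0 g \<longleftrightarrow> integrable lborel g \<and> continuous_on UNIV g \<and> bounded (range g)"

fun space_norm :: "space \<Rightarrow> (real \<Rightarrow> real) \<Rightarrow> real" where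
  "space_norm W11 g =
     (LINT x|lborel. \<bar>g x\<bar>) + (LINT x|lborel. \<bar>(SOME h. weak_deriv g h) x\<bar>)"
| "space_norm L1C0 g = (LINT x|lborel. \<bar>g x\<bar>) + (SUP x. \<bar>g x\<bar>)"

definition dispersion :: "(real \<Rightarrow> real) \<Rightarrow> real \<Rightarrow> complex \<Rightarrow> complex" where
  "dispersion df k u =
     1 + (1 / complex_of_real (k\<^sup>2)) *
         (LINT p|lborel. complex_of_real (df p) / (u - complex_of_real p))"

text \<open>Spectral stability (via the dispersion relation) for the set K of admissible
  wavenumbers, in terms of df = f0'.\<close>
definition spectrally_stable :: "real set \<Rightarrow> (real \<Rightarrow> real) \<Rightarrow> bool" where
  "spectrally_stable K df \<longleftrightarrow>
     (\<forall>k\<in>K. \<forall>u. 0 < Im u \<longrightarrow> dispersion df k u \<noteq> 0)"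

end

theory Submission
  imports Defs "HOL-Computational_Algebra.Polynomial" "HOL-Probability.Sinc_Integral"
    "HOL-Real_Asymp.Real_Asymp"
begin

text \<open>
  Fix an admissible \<open>k\<close> and put \<open>u = R + i\<eta>\<close>. For fixed \<open>\<eta>\<close> the Cauchy integral \<open>h\<close> of \<open>f0'\<close> at
  \<open>u\<close> tends to \<open>0\<close> as \<open>R\<close> grows, so a perturbation concentrated near \<open>R\<close> only has to produce a
  Cauchy integral \<open>-k\<^sup>2 - h\<close> close to \<open>-k\<^sup>2\<close>. The function
  \<open>(a arctan ((p - R)/\<eta>) + b) / (1 + (p - R)\<^sup>2)\<close> has norm \<open>O(\<bar>a\<bar> + \<bar>b\<bar>)\<close> in both spaces,
  uniformly in \<open>\<eta>\<close>. Its odd part contributes \<open>-aJ\<close>, where \<open>J\<close> is at least of order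
  \<open>ln (1/\<eta>)\<close>, and its even part \<open>-ibE\<close> with \<open>E > 0\<close>. Choosing first \<open>\<eta>\<close> small and then \<open>R\<close>
  large makes the exact solutions \<open>a = (k\<^sup>2 + Re h)/J\<close> and \<open>b = Im h/E\<close> arbitrarily small.

  The \<open>W11\<close> norm is computed from an arbitrarily chosen weak derivative, so a bound on it needs
  the almost everywhere uniqueness of weak derivatives, hence a supply of test functions.
\<close>

section \<open>Smooth bumps and uniqueness of weak derivatives\<close>

text \<open>These are the shapes that arise when \<open>exp (- (1 / x))\<close>, extended by zero,
  is differentiated repeatedly: only the polynomial in \<open>1 / x\<close> changes.\<close>

definition flat :: "real poly \<Rightarrow> real \<Rightarrow> real" where
  "flat p x = (if 0 < x then poly p (1 / x) * exp (- (1 / x)) else 0)"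

lemma tendsto_poly_mult_exp_minus: "((\<lambda>y. poly p y * exp (- y)) \<longlongrightarrow> 0) at_top"
  for p :: "real poly"
proof -
  have "((\<lambda>y. \<Sum>i\<le>degree p. coeff p i * (y ^ i / exp y)) \<longlongrightarrow> (\<Sum>i\<le>degree p. coeff p i * 0)) at_top"
    by (intro tendsto_intros tendsto_power_div_exp_0)
  then show ?thesis
    by (simp add: poly_altdef sum_distrib_right sum_divide_distrib exp_minus field_simps)
qed

text \<open>With \<open>y = 1 / x\<close> the inner derivative is \<open>- y\<^sup>2\<close>, so
  \<open>poly p y * exp (- y)\<close> turns into
  \<open>y\<^sup>2 * poly (p - pderiv p) y * exp (- y)\<close>, and \<open>[:0, 0, 1:]\<close> is
  the factor \<open>y\<^sup>2\<close>. At the origin exponential decay beats every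
  polynomial.\<close>

lemma flat_has_real_derivative:
  "(flat p has_real_derivative flat ([:0, 0, 1:] * (p - pderiv p)) x) (at x)"
proof -
  consider "x > 0" | "x < 0" | "x = 0" by linarith
  then show ?thesis
  proof cases
    case 1
    have "((\<lambda>y. poly p (1 / y) * exp (- (1 / y))) has_real_derivative
        flat ([:0, 0, 1:] * (p - pderiv p)) x) (at x)"
      using 1 unfolding flat_def
      by (auto intro!: derivative_eq_intros DERIV_chain2[OF poly_DERIV]
          simp: power2_eq_square algebra_simps)
    moreover have "eventually (\<lambda>y. poly p (1 / y) * exp (- (1 / y)) = flat p y) (nhds x)"
      using eventually_nhds_in_open[of "{0<..}" x] 1
      by (auto simp: flat_def elim!: eventually_mono)
    ultimately show ?thesis
      by (rule DERIV_cong_ev[OF refl _ refl, THEN iffD1, rotated])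
  next
    case 2
    have "eventually (\<lambda>y. 0 = flat p y) (nhds x)"
      using eventually_nhds_in_open[of "{..<0}" x] 2
      by (auto simp: flat_def elim!: eventually_mono)
    then have "((\<lambda>_. 0) has_real_derivative 0) (at x) \<longleftrightarrow> (flat p has_real_derivative 0) (at x)"
      by (intro DERIV_cong_ev) auto
    then show ?thesis using 2 by (simp add: flat_def)
  next
    case 3
    \<comment> \<open>The factor \<open>1 / h\<close> of the difference quotient is absorbed into
      the polynomial as \<open>[:0, 1:]\<close>.\<close>
    have r: "((\<lambda>h. poly ([:0, 1:] * p) (inverse h) * exp (- inverse h)) \<longlongrightarrow> 0) (at_right 0)"
      by (rule filterlim_compose[OF tendsto_poly_mult_exp_minus filterlim_inverse_at_top_right])
    have "((\<lambda>h. (flat p (0 + h) - flat p 0) / h) \<longlongrightarrow> 0) (at_right 0)"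
      by (rule Lim_transform_eventually[OF r])
         (auto simp: eventually_at_filter flat_def field_simps)
    moreover have "((\<lambda>h. (flat p (0 + h) - flat p 0) / h) \<longlongrightarrow> 0) (at_left 0)"
      by (rule Lim_transform_eventually[OF tendsto_const])
         (auto simp: eventually_at_filter flat_def)
    ultimately have "((\<lambda>h. (flat p (0 + h) - flat p 0) / h) \<longlongrightarrow> 0) (at 0)"
      by (rule filterlim_split_at[rotated])
    then show ?thesis using 3 by (simp add: DERIV_def flat_def)
  qed
qed

text \<open>Dilation sharpens the smooth step into the indicator of the open half-line, which makes
  half-line indicators pointwise limits of test functions.\<close>

lemma flat_1_tendsto: "(\<lambda>n. flat 1 (real n * y)) \<longlonglongrightarrow> (if 0 < y then 1 else 0)"
proof (cases "0 < y")
  case True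
  have "(\<lambda>n. exp (- (1 / (real n * y)))) \<longlonglongrightarrow> exp (- 0)"
    using True by real_asymp
  moreover have "\<forall>\<^sub>F n in sequentially. exp (- (1 / (real n * y))) = flat 1 (real n * y)"
    using eventually_gt_at_top[of 0] by eventually_elim (use True in \<open>auto simp: flat_def\<close>)
  ultimately show ?thesis
    using True by (auto dest: Lim_transform_eventually)
next
  case False
  then show ?thesis by (auto simp: flat_def zero_less_mult_iff)
qed

lemma flat_1_bounds: "0 \<le> flat 1 x" "flat 1 x \<le> 1"
  by (auto simp: flat_def)

text \<open>The bumps \<open>flat p (s (x - a)) * flat q (s (b - x))\<close> span a space closed under
  differentiation, which replaces a Leibniz rule for iterated derivatives.\<close>

inductive_set bumps :: "real \<Rightarrow> real \<Rightarrow> real \<Rightarrow> (real \<Rightarrow> real) set" for s a b where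
  bump: "(\<lambda>x. flat p (s * (x - a)) * flat q (s * (b - x))) \<in> bumps s a b"
| add: "f \<in> bumps s a b \<Longrightarrow> g \<in> bumps s a b \<Longrightarrow> (\<lambda>x. f x + g x) \<in> bumps s a b"

lemma flat_smult: "flat (smult c p) x = c * flat p x"
  by (simp add: flat_def)

lemma bumps_derivative:
  "f \<in> bumps s a b \<Longrightarrow> \<exists>g\<in>bumps s a b. \<forall>x. (f has_real_derivative g x) (at x)"
proof (induction rule: bumps.induct)
  case (bump p q)
  define D where "D p = [:0, 0, 1:] * (p - pderiv p)" for p :: "real poly"
  \<comment> \<open>Product rule: the inner derivatives \<open>s\<close> and \<open>- s\<close> are
    moved into the polynomials, so both summands are again generators.\<close>
  let ?g = "\<lambda>x. flat (smult s (D p)) (s * (x - a)) * flat q (s * (b - x)) +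
                 flat (smult (- s) p) (s * (x - a)) * flat (D q) (s * (b - x))"
  have "((\<lambda>x. flat p (s * (x - a)) * flat q (s * (b - x))) has_real_derivative ?g x) (at x)" for x
    unfolding D_def flat_smult
    by (rule derivative_eq_intros DERIV_chain2[OF flat_has_real_derivative] refl | simp)+
  moreover have "?g \<in> bumps s a b"
    by (intro bumps.intros)
  ultimately show ?case by (intro bexI[of _ ?g] allI)
next
  case (add f g)
  then obtain f' g' where "f' \<in> bumps s a b" "g' \<in> bumps s a b"
    "\<forall>x. (f has_real_derivative f' x) (at x)" "\<forall>x. (g has_real_derivative g' x) (at x)"
    by blast
  then show ?case
    by (intro bexI[of _ "\<lambda>x. f' x + g' x"]) (auto intro: DERIV_add bumps.intros)
qed

lemma funpow_deriv_bumps: "f \<in> bumps s a b \<Longrightarrow> (deriv ^^ n) f \<in> bumps s a b"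
proof (induction n)
  case (Suc n)
  then obtain g where g: "g \<in> bumps s a b" "\<forall>x. ((deriv ^^ n) f has_real_derivative g x) (at x)"
    using bumps_derivative by blast
  then have "deriv ((deriv ^^ n) f) = g"
    by (auto intro: DERIV_imp_deriv)
  with g show ?case by simp
qed simp

lemma test_function_bump:
  assumes "0 \<le> s"
  shows "test_function (\<lambda>x. flat 1 (s * (x - a)) * flat 1 (s * (b - x)))"
  unfolding test_function_def
proof (intro conjI allI)
  fix n x
  show "(deriv ^^ n) (\<lambda>x. flat 1 (s * (x - a)) * flat 1 (s * (b - x))) differentiable at x"
    using bumps_derivative[OF funpow_deriv_bumps[OF bumps.bump[of 1 s a 1 b], of n]]
    by (auto simp: real_differentiable_def)
next
  show "\<exists>R. \<forall>x. R < \<bar>x\<bar> \<longrightarrow> flat 1 (s * (x - a)) * flat 1 (s * (b - x)) = 0"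
  proof (intro exI[of _ "\<bar>a\<bar> + \<bar>b\<bar>"] allI impI)
    fix x :: real
    assume "\<bar>a\<bar> + \<bar>b\<bar> < \<bar>x\<bar>"
    then have "x - a \<le> 0 \<or> b - x \<le> 0" by linarith
    then show "flat 1 (s * (x - a)) * flat 1 (s * (b - x)) = 0"
      using assms by (auto simp: flat_def zero_less_mult_iff)
  qed
qed

lemma test_function_continuous_on:
  assumes "test_function \<phi>"
  shows "continuous_on UNIV \<phi>"
proof -
  have "(deriv ^^ 0) \<phi> differentiable at x" for x
    using assms unfolding test_function_def by blast
  then show ?thesis
    by (simp add: continuous_on_eq_continuous_at differentiable_imp_continuous_within)
qed

text \<open>Bumps with values in the unit interval converge pointwise to the indicator of
  \<open>{a<..}\<close>, and \<open>\<bar>d x\<bar>\<close> dominates the products.\<close>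

lemma integral_half_line_zero:
  fixes d :: "real \<Rightarrow> real"
  assumes d: "integrable lborel d"
    and zero: "\<And>\<phi>. test_function \<phi> \<Longrightarrow> (LINT x|lborel. d x * \<phi> x) = 0"
  shows "(LINT x|lborel. d x * indicator {a<..} x) = 0"
proof -
  \<comment> \<open>The left edge stays at \<open>a\<close> and sharpens; the right edge sits at
    \<open>n\<close> and escapes to infinity, so each \<open>\<phi> n\<close> still has bounded
    support.\<close>
  define \<phi> where "\<phi> n x = flat 1 (real n * (x - a)) * flat 1 (real n * (real n - x))" for n x
  have tf: "test_function (\<phi> n)" for n
    unfolding \<phi>_def by (rule test_function_bump) simp
  have meas[measurable]: "\<phi> n \<in> borel_measurable borel" for n
    by (intro borel_measurable_continuous_onI test_function_continuous_on tf)
  have lim: "(\<lambda>n. \<phi> n x) \<longlonglongrightarrow> indicator {a<..} x" for x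
  proof -
    have "(\<lambda>n. flat 1 (real n * (real n - x))) \<longlonglongrightarrow> 1"
    proof (rule Lim_transform_eventually)
      show "(\<lambda>n. exp (- (1 / (real n * (real n - x))))) \<longlonglongrightarrow> 1" by real_asymp
      show "\<forall>\<^sub>F n in sequentially. exp (- (1 / (real n * (real n - x)))) = flat 1 (real n * (real n - x))"
        using eventually_gt_at_top[of "nat \<lceil>\<bar>x\<bar>\<rceil>"]
      proof eventually_elim
        case (elim n)
        then have "real n > \<bar>x\<bar>" by linarith
        then have "0 < real n * (real n - x)" by (auto intro!: mult_pos_pos)
        then show ?case by (simp add: flat_def)
      qed
    qed
    from tendsto_mult[OF flat_1_tendsto[of "x - a"] this] show ?thesis
      unfolding \<phi>_def by (auto simp: indicator_def)
  qed
  have dm[measurable]: "d \<in> borel_measurable borel" using d by auto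
  have "(\<lambda>n. LINT x|lborel. d x * \<phi> n x) \<longlonglongrightarrow> (LINT x|lborel. d x * indicator {a<..} x)"
  proof (rule integral_dominated_convergence[where w="\<lambda>x. \<bar>d x\<bar>"])
    show "AE x in lborel. (\<lambda>n. d x * \<phi> n x) \<longlonglongrightarrow> d x * indicator {a<..} x"
      by (intro AE_I2 tendsto_intros lim)
    have "\<bar>\<phi> n x\<bar> \<le> 1" for n x
      unfolding \<phi>_def abs_mult using flat_1_bounds by (intro mult_le_one) (auto simp: abs_le_iff)
    then show "AE x in lborel. norm (d x * \<phi> n x) \<le> \<bar>d x\<bar>" for n
      by (intro AE_I2) (auto simp: abs_mult intro!: mult_left_le)
  qed (use d in auto)
  then show ?thesis
    using zero[OF tf] by (simp add: LIMSEQ_const_iff)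
qed

text \<open>The positive and negative parts of \<open>d\<close> define finite measures that agree on
  all half-lines, hence coincide. Densities are unique almost everywhere, and two parts that are
  never both positive can only agree where both vanish.\<close>

lemma AE_zero_if_half_line_integrals_zero:
  fixes d :: "real \<Rightarrow> real"
  assumes d: "integrable lborel d"
    and zero: "\<And>a. (LINT x|lborel. d x * indicator {a<..} x) = 0"
  shows "AE x in lborel. d x = 0"
proof -
  have [measurable]: "d \<in> borel_measurable borel" using d by auto
  let ?p = "\<lambda>x. max 0 (d x)" and ?n = "\<lambda>x. max 0 (- d x)"
  have int: "integrable lborel (\<lambda>x. ?p x * indicator {a<..} x)"
      "integrable lborel (\<lambda>x. ?n x * indicator {a<..} x)" for a
    by (rule Bochner_Integration.integrable_bound[OF d]; auto simp: indicator_def)+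
  have em: "emeasure (density lborel (\<lambda>x. ennreal (f x))) {a<..} =
      ennreal (LINT x|lborel. f x * indicator {a<..} x)"
    if [measurable]: "f \<in> borel_measurable borel" and "\<And>x. 0 \<le> f x"
      and "integrable lborel (\<lambda>x. f x * indicator {a<..} x)" for f :: "real \<Rightarrow> real" and a
  proof -
    have "emeasure (density lborel (\<lambda>x. ennreal (f x))) {a<..} =
        (\<integral>\<^sup>+x. ennreal (f x * indicator {a<..} x) \<partial>lborel)"
      by (subst emeasure_density) (auto intro!: nn_integral_cong simp: indicator_def)
    then show ?thesis
      using that by (simp add: nn_integral_eq_integral)
  qed
  have "density lborel (\<lambda>x. ennreal (?p x)) = density lborel (\<lambda>x. ennreal (?n x))"
  proof (rule measure_eqI_lessThan)
    fix a :: real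
    have "(LINT x|lborel. ?p x * indicator {a<..} x) - (LINT x|lborel. ?n x * indicator {a<..} x)
        = (LINT x|lborel. d x * indicator {a<..} x)"
      by (subst Bochner_Integration.integral_diff[symmetric, OF int])
         (auto intro!: Bochner_Integration.integral_cong simp: indicator_def)
    then show "emeasure (density lborel (\<lambda>x. ennreal (?p x))) {a<..} =
        emeasure (density lborel (\<lambda>x. ennreal (?n x))) {a<..}"
      using zero[of a] int[of a] by (simp add: em)
    show "emeasure (density lborel (\<lambda>x. ennreal (?p x))) {a<..} < \<infinity>"
      using int[of a] by (simp add: em)
  qed auto
  then have "AE x in lborel. ennreal (?p x) = ennreal (?n x)"
    by (intro sigma_finite_measure.density_unique[OF lborel.sigma_finite_measure_axioms]) auto
  then show ?thesis
    by eventually_elim (auto simp: max_def split: if_splits)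
qed

text \<open>The difference of two weak derivatives is integrable and annihilates every test
  function.\<close>

lemma weak_deriv_unique:
  assumes "weak_deriv g h1" and "weak_deriv g h2"
  shows "AE x in lborel. h1 x = h2 x"
proof -
  have int: "integrable lborel h1" "integrable lborel h2"
    using assms by (auto simp: weak_deriv_def)
  have "(LINT x|lborel. (h1 x - h2 x) * \<phi> x) = 0" if \<phi>: "test_function \<phi>" for \<phi>
  proof -
    have cont: "continuous_on UNIV \<phi>"
      using \<phi> by (rule test_function_continuous_on)
    then have [measurable]: "\<phi> \<in> borel_measurable borel" by (rule borel_measurable_continuous_onI)
    obtain R where R: "\<And>x. R < \<bar>x\<bar> \<Longrightarrow> \<phi> x = 0" using \<phi> by (auto simp: test_function_def)
    have "bounded (\<phi> ` {-R..R})"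
      by (intro compact_imp_bounded compact_continuous_image continuous_on_subset[OF cont]) auto
    then obtain M where M: "\<forall>y\<in>\<phi> ` {-R..R}. norm y \<le> M"
      unfolding bounded_iff ..
    have bd: "\<bar>\<phi> x\<bar> \<le> \<bar>M\<bar>" for x
    proof (cases "R < \<bar>x\<bar>")
      case False
      then have "\<phi> x \<in> \<phi> ` {-R..R}" by (intro imageI) auto
      from bspec[OF M this] have "\<bar>\<phi> x\<bar> \<le> M" by simp
      then show ?thesis by linarith
    qed (simp add: R)
    \<comment> \<open>Test functions are bounded, so both products are integrable and the integral
      of the difference splits.\<close>
    have i: "integrable lborel (\<lambda>x. h x * \<phi> x)" if "integrable lborel h" for h
    proof (rule Bochner_Integration.integrable_bound)
      show "integrable lborel (\<lambda>x. h x * M)" using that by simp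
      show "AE x in lborel. norm (h x * \<phi> x) \<le> norm (h x * M)"
        using mult_left_mono[OF bd abs_ge_zero] by (simp add: abs_mult)
    qed (use that in auto)
    have eq: "(LINT x|lborel. g x * deriv \<phi> x) = - (LINT x|lborel. h x * \<phi> x)"
      if "weak_deriv g h" for h
      using that \<phi> by (simp add: weak_deriv_def)
    show ?thesis
      using eq[OF assms(1)] eq[OF assms(2)]
      by (simp add: left_diff_distrib i[OF int(1)] i[OF int(2)])
  qed
  then have "AE x in lborel. h1 x - h2 x = 0"
    by (intro AE_zero_if_half_line_integrals_zero integral_half_line_zero
        Bochner_Integration.integrable_diff int)
  then show ?thesis by simp
qed

text \<open>Integration by parts on a bounded interval outside which the test function and its
  derivative vanish.\<close>

lemma weak_deriv_if_DERIV:
  fixes g g' :: "real \<Rightarrow> real"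
  assumes der: "\<And>x. (g has_real_derivative g' x) (at x)"
    and cont: "continuous_on UNIV g'" and int: "integrable lborel g'"
  shows "weak_deriv g g'"
  unfolding weak_deriv_def
proof (intro conjI allI impI int)
  fix \<phi> assume \<phi>: "test_function \<phi>"
  then obtain R where R: "\<And>x. R < \<bar>x\<bar> \<Longrightarrow> \<phi> x = 0" by (auto simp: test_function_def)
  have d0: "(deriv ^^ n) \<phi> differentiable at x" for n x
    using \<phi> by (auto simp: test_function_def)
  have D: "(\<phi> has_real_derivative deriv \<phi> x) (at x)" for x
    using d0[of 0 x] by (simp add: DERIV_deriv_iff_real_differentiable)
  have cD: "isCont (deriv \<phi>) x" for x
    using d0[of 1 x] by (simp add: differentiable_imp_continuous_within)
  \<comment> \<open>The extra 1 puts the endpoints strictly beyond \<open>R\<close>, so the boundary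
    terms vanish too.\<close>
  define S where "S = \<bar>R\<bar> + 1"
  have out: "\<phi> x = 0" "deriv \<phi> x = 0" if "x \<notin> {-S..S}" for x
  proof -
    have x: "R < \<bar>x\<bar>" using that by (auto simp: S_def)
    then show "\<phi> x = 0" by (rule R)
    have "eventually (\<lambda>y. \<phi> y = 0) (nhds x)"
    proof -
      have "open {y. R < \<bar>y\<bar>}" by (intro open_Collect_less continuous_intros)
      from eventually_nhds_in_open[OF this, of x] show ?thesis
        using x R by (auto elim!: eventually_mono)
    qed
    then have "(\<phi> has_real_derivative 0) (at x) \<longleftrightarrow> ((\<lambda>_. 0) has_real_derivative 0) (at x)"
      by (intro DERIV_cong_ev) auto
    then show "deriv \<phi> x = 0" by (intro DERIV_imp_deriv) simp
  qed
  have "(LINT x|lborel. g x * deriv \<phi> x) = (LINT x|lborel. g x * deriv \<phi> x * indicator {-S..S} x)"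
    using out by (intro Bochner_Integration.integral_cong) (auto simp: indicator_def)
  also have "\<dots> = g S * \<phi> S - g (-S) * \<phi> (-S) - (LINT x|lborel. g' x * \<phi> x * indicator {-S..S} x)"
    by (rule integral_by_parts) (use cont der D cD in \<open>auto simp: S_def continuous_on_eq_continuous_at\<close>)
  also have "(LINT x|lborel. g' x * \<phi> x * indicator {-S..S} x) = (LINT x|lborel. g' x * \<phi> x)"
    using out by (intro Bochner_Integration.integral_cong) (auto simp: indicator_def)
  finally show "(LINT x|lborel. g x * deriv \<phi> x) = - (LINT x|lborel. g' x * \<phi> x)"
    using R[of S] R[of "- S"] by (simp add: S_def)
qed

text \<open>Summing all three quantities gives one bound for either norm. In \<open>W11\<close> the
  weak derivative picked by \<open>SOME\<close> agrees with \<open>g'\<close> almost everywhere; in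
  \<open>L1C0\<close> the supremum is at most \<open>M\<close>.\<close>

lemma in_space_if_DERIV:
  fixes g g' :: "real \<Rightarrow> real"
  assumes der: "\<And>x. (g has_real_derivative g' x) (at x)"
    and cont: "continuous_on UNIV g'"
    and int: "integrable lborel g" "integrable lborel g'"
    and bd: "\<And>x. \<bar>g x\<bar> \<le> M"
  shows "in_space B g"
    and "space_norm B g \<le> (LINT x|lborel. \<bar>g x\<bar>) + (LINT x|lborel. \<bar>g' x\<bar>) + M"
proof -
  have wd: "weak_deriv g g'" by (rule weak_deriv_if_DERIV[OF der cont int(2)])
  have cg: "continuous_on UNIV g"
    using der by (intro DERIV_continuous_on) (auto intro: DERIV_subset)
  show "in_space B g"
    using int wd cg bd by (cases B) (auto simp: bounded_iff)
  have M: "0 \<le> M" using bd[of 0] by linarith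
  show "space_norm B g \<le> (LINT x|lborel. \<bar>g x\<bar>) + (LINT x|lborel. \<bar>g' x\<bar>) + M"
  proof (cases B)
    case W11
    have wd': "weak_deriv g (SOME h. weak_deriv g h)"
      by (rule someI[of "weak_deriv g", OF wd])
    have "(LINT x|lborel. \<bar>(SOME h. weak_deriv g h) x\<bar>) = (LINT x|lborel. \<bar>g' x\<bar>)"
    proof (rule integral_cong_AE)
      show "AE x in lborel. \<bar>(SOME h. weak_deriv g h) x\<bar> = \<bar>g' x\<bar>"
        using weak_deriv_unique[OF wd' wd] by eventually_elim simp
    qed (use wd wd' in \<open>auto simp: weak_deriv_def\<close>)
    then show ?thesis using W11 M by simp
  next
    case L1C0
    have "(SUP x. \<bar>g x\<bar>) \<le> M" by (rule cSUP_least) (auto simp: bd)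
    moreover have "0 \<le> (LINT x|lborel. \<bar>g' x\<bar>)" by (rule Bochner_Integration.integral_nonneg) simp
    ultimately show ?thesis unfolding L1C0 space_norm.simps by linarith
  qed
qed

section \<open>Integrals of the Lorentzian and of its rescalings\<close>

lemma integrable_inverse_one_plus_square: "integrable lborel (\<lambda>x::real. 1 / (1 + x\<^sup>2))"
  and integral_inverse_one_plus_square: "(LINT x|lborel. 1 / (1 + (x::real)\<^sup>2)) = pi"
  using integrable_inverse_1_plus_square LBINT_inverse_1_plus_square
  by (simp_all add: set_integrable_def set_lebesgue_integral_def
      interval_lebesgue_integral_def einterval_def inverse_eq_divide)

text \<open>Substituting \<open>x / \<eta>\<close> preserves the total mass. This scale invariance
  keeps the norm of a steep arctan step bounded as \<open>\<eta>\<close> shrinks.\<close>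

lemma integrable_inverse_one_plus_square_scaled:
    "0 < \<eta> \<Longrightarrow> integrable lborel (\<lambda>x::real. 1 / \<eta> / (1 + (x / \<eta>)\<^sup>2))"
  and integral_inverse_one_plus_square_scaled:
    "0 < \<eta> \<Longrightarrow> (LINT x|lborel. 1 / \<eta> / (1 + (x / \<eta>)\<^sup>2)) = pi"
proof -
  assume \<eta>: "0 < \<eta>"
  have "integrable lborel (\<lambda>x::real. 1 / \<eta> * (1 / (1 + (0 + (1 / \<eta>) * x)\<^sup>2)))"
    using lborel_integrable_real_affine[OF integrable_inverse_one_plus_square, of "1 / \<eta>" 0] \<eta>
    by (intro integrable_mult_right) simp
  then show "integrable lborel (\<lambda>x::real. 1 / \<eta> / (1 + (x / \<eta>)\<^sup>2))" by simp
  have "pi = \<bar>1 / \<eta>\<bar> *\<^sub>R (LINT x|lborel. 1 / (1 + (0 + (1 / \<eta>) * x)\<^sup>2))"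
    using lborel_integral_real_affine[of "1 / \<eta>" "\<lambda>x. 1 / (1 + x\<^sup>2)" 0] \<eta>
    by (simp add: integral_inverse_one_plus_square)
  also have "\<dots> = (LINT x|lborel. 1 / \<eta> * (1 / (1 + (0 + (1 / \<eta>) * x)\<^sup>2)))"
    using \<eta> by (subst integral_mult_right_zero) simp
  finally show "(LINT x|lborel. 1 / \<eta> / (1 + (x / \<eta>)\<^sup>2)) = pi" by simp
qed

lemma integrable_bounded_over_one_plus_square:
  fixes f :: "real \<Rightarrow> real"
  assumes [measurable]: "f \<in> borel_measurable borel" and "\<And>x. \<bar>f x\<bar> \<le> C"
  shows "integrable lborel (\<lambda>x. f x / (1 + x\<^sup>2))"
proof (rule Bochner_Integration.integrable_bound)
  show "integrable lborel (\<lambda>x::real. C * (1 / (1 + x\<^sup>2)))"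
    by (intro integrable_mult_right integrable_inverse_one_plus_square)
  have "\<bar>f x / (1 + x\<^sup>2)\<bar> \<le> \<bar>C * (1 / (1 + x\<^sup>2))\<bar>" for x
    using assms(2)[of x] by (auto simp: abs_mult intro!: divide_right_mono)
  then show "AE x in lborel. norm (f x / (1 + x\<^sup>2)) \<le> norm (C * (1 / (1 + x\<^sup>2)))" by simp
qed simp

section \<open>The perturbation profile\<close>

definition profile :: "real \<Rightarrow> real \<Rightarrow> real \<Rightarrow> real \<Rightarrow> real" where
  "profile \<eta> a b p = (a * arctan (p / \<eta>) + b) / (1 + p\<^sup>2)"

definition profile_deriv :: "real \<Rightarrow> real \<Rightarrow> real \<Rightarrow> real \<Rightarrow> real" where
  "profile_deriv \<eta> a b p = a * (1 / \<eta> / (1 + (p / \<eta>)\<^sup>2)) / (1 + p\<^sup>2)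
     - (a * arctan (p / \<eta>) + b) * (2 * p) / (1 + p\<^sup>2)\<^sup>2"

lemma one_plus_square_neq_0: "1 + (x::real)\<^sup>2 \<noteq> 0"
  by (metis add_pos_nonneg less_irrefl zero_le_power2 zero_less_one)

lemma profile_has_real_derivative:
  "(profile \<eta> a b has_real_derivative profile_deriv \<eta> a b p) (at p)"
proof -
  have "((\<lambda>p. (a * arctan (p / \<eta>) + b) / (1 + p\<^sup>2)) has_real_derivative
      ((a * (inverse (1 + (p / \<eta>)\<^sup>2) * (1 / \<eta>)) + 0) * (1 + p\<^sup>2) - (a * arctan (p / \<eta>) + b) * (0 + 2 * p))
       / ((1 + p\<^sup>2) * (1 + p\<^sup>2))) (at p)"
    using one_plus_square_neq_0[of p]
    by (intro DERIV_divide DERIV_add DERIV_cmult DERIV_const DERIV_chain2[OF DERIV_arctan] DERIV_cdivide DERIV_ident)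
       (auto intro!: derivative_eq_intros)
  moreover have "((a * (inverse (1 + (p / \<eta>)\<^sup>2) * (1 / \<eta>)) + 0) * (1 + p\<^sup>2) - (a * arctan (p / \<eta>) + b) * (0 + 2 * p))
       / ((1 + p\<^sup>2) * (1 + p\<^sup>2)) = profile_deriv \<eta> a b p"
    using one_plus_square_neq_0[of p]
    by (simp add: profile_deriv_def diff_divide_distrib power2_eq_square inverse_eq_divide)
  ultimately show ?thesis
    unfolding profile_def by simp
qed

lemma profile_deriv_continuous: "0 < \<eta> \<Longrightarrow> continuous_on UNIV (profile_deriv \<eta> a b)"
  unfolding profile_deriv_def
  by (intro continuous_intros) (auto simp: one_plus_square_neq_0)

lemma abs_arctan_le_2: "\<bar>arctan x\<bar> \<le> 2"
  using arctan_lbound[of x] arctan_ubound[of x] pi_less_4 by (simp add: abs_le_iff)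

lemma abs_amplitude_le: "\<bar>a * arctan x + b\<bar> \<le> 2 * (\<bar>a\<bar> + \<bar>b\<bar>)"
proof -
  have "\<bar>a * arctan x + b\<bar> \<le> \<bar>a\<bar> * \<bar>arctan x\<bar> + \<bar>b\<bar>"
    unfolding abs_mult[symmetric] by (rule abs_triangle_ineq)
  also have "\<dots> \<le> \<bar>a\<bar> * 2 + \<bar>b\<bar> * 2"
    by (intro add_mono mult_left_mono abs_arctan_le_2) auto
  finally show ?thesis by (simp add: algebra_simps)
qed

lemma abs_profile_le: "\<bar>profile \<eta> a b p\<bar> \<le> 2 * (\<bar>a\<bar> + \<bar>b\<bar>) * (1 / (1 + p\<^sup>2))"
  using abs_amplitude_le[of a "p / \<eta>" b]
  by (auto simp: profile_def abs_mult intro!: divide_right_mono)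

text \<open>Differentiating the arctan yields a Lorentzian of width \<open>\<eta>\<close> and mass
  \<open>pi\<close>; in the other term \<open>\<bar>2 * p\<bar> \<le> 1 + p\<^sup>2\<close> cancels
  one power of the denominator.\<close>

lemma abs_profile_deriv_le:
  assumes "0 < \<eta>"
  shows "\<bar>profile_deriv \<eta> a b p\<bar> \<le>
    \<bar>a\<bar> * (1 / \<eta> / (1 + (p / \<eta>)\<^sup>2)) + 2 * (\<bar>a\<bar> + \<bar>b\<bar>) * (1 / (1 + p\<^sup>2))"
proof -
  define L where "L = 1 / \<eta> / (1 + (p / \<eta>)\<^sup>2)"
  have L: "0 \<le> L" using assms by (simp add: L_def)
  have p: "\<bar>2 * p\<bar> \<le> 1 + p\<^sup>2"
    using zero_le_power2[of "p - 1"] zero_le_power2[of "p + 1"]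
    by (auto simp: power2_eq_square algebra_simps abs_le_iff)
  have pos: "0 < 1 + p\<^sup>2" by (simp add: add_pos_nonneg)
  have "\<bar>a * L / (1 + p\<^sup>2)\<bar> \<le> \<bar>a\<bar> * L / 1"
    unfolding abs_divide abs_mult using L pos by (intro frac_le) auto
  moreover have "\<bar>(a * arctan (p / \<eta>) + b) * (2 * p) / (1 + p\<^sup>2)\<^sup>2\<bar>
      \<le> 2 * (\<bar>a\<bar> + \<bar>b\<bar>) * (1 + p\<^sup>2) / (1 + p\<^sup>2)\<^sup>2"
    unfolding abs_divide abs_mult[of "a * arctan (p / \<eta>) + b"] abs_power2[of "1 + p\<^sup>2"]
    using p by (intro divide_right_mono mult_mono abs_amplitude_le) auto
  moreover have "2 * (\<bar>a\<bar> + \<bar>b\<bar>) * (1 + p\<^sup>2) / (1 + p\<^sup>2)\<^sup>2 = 2 * (\<bar>a\<bar> + \<bar>b\<bar>) * (1 / (1 + p\<^sup>2))"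
    using pos by (simp add: power2_eq_square)
  ultimately show ?thesis
    unfolding profile_deriv_def L_def[symmetric] by linarith
qed

lemma profile_measurable[measurable]: "profile \<eta> a b \<in> borel_measurable borel"
  unfolding profile_def by measurable

lemma profile_deriv_measurable[measurable]: "profile_deriv \<eta> a b \<in> borel_measurable borel"
  unfolding profile_deriv_def by measurable

lemma integrable_profile: "integrable lborel (profile \<eta> a b)"
  unfolding profile_def
  by (rule integrable_bounded_over_one_plus_square[OF _ abs_amplitude_le]) measurable

text \<open>The bound is uniform in \<open>\<eta>\<close>: steepening the step does not change its height.\<close>

lemma profile_in_space:
  assumes \<eta>: "0 < \<eta>"
  shows "in_space B (\<lambda>p. profile \<eta> a b (p - R))"
    and "space_norm B (\<lambda>p. profile \<eta> a b (p - R)) \<le> 22 * (\<bar>a\<bar> + \<bar>b\<bar>)"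
proof -
  define s where "s = \<bar>a\<bar> + \<bar>b\<bar>"
  have s: "0 \<le> s" "\<bar>a\<bar> \<le> s" by (auto simp: s_def)
  let ?w = "\<lambda>p::real. \<bar>a\<bar> * (1 / \<eta> / (1 + (p / \<eta>)\<^sup>2)) + 2 * s * (1 / (1 + p\<^sup>2))"
  have w: "integrable lborel ?w"
    by (intro Bochner_Integration.integrable_add integrable_mult_right
        integrable_inverse_one_plus_square integrable_inverse_one_plus_square_scaled \<eta>)
  have int': "integrable lborel (profile_deriv \<eta> a b)"
  proof (rule Bochner_Integration.integrable_bound[OF w])
    have "norm (profile_deriv \<eta> a b p) \<le> norm (?w p)" for p
      unfolding real_norm_def using abs_profile_deriv_le[OF \<eta>, of a b p] abs_ge_self[of "?w p"]
      by (simp only: s_def)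
    then show "AE p in lborel. norm (profile_deriv \<eta> a b p) \<le> norm (?w p)" by simp
  qed simp
  have shift: "integrable lborel (\<lambda>p. f (p - R))" if "integrable lborel f" for f :: "real \<Rightarrow> real"
    using lborel_integrable_real_affine[OF that, of 1 "- R"] by simp
  have shift_eq: "(LINT p|lborel. f (p - R)) = (LINT p|lborel. f p)" for f :: "real \<Rightarrow> real"
    using lborel_integral_real_affine[of 1 f "- R"] by simp
  have der: "((\<lambda>p. profile \<eta> a b (p - R)) has_real_derivative profile_deriv \<eta> a b (p - R)) (at p)" for p
  proof -
    have "((\<lambda>p. p - R) has_real_derivative 1) (at p)" by (auto intro!: derivative_eq_intros)
    from DERIV_chain2[OF profile_has_real_derivative this] show ?thesis by simp
  qed
  have cont: "continuous_on UNIV (\<lambda>p. profile_deriv \<eta> a b (p - R))"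
    by (rule continuous_on_compose2[OF profile_deriv_continuous[OF \<eta>]]) (auto intro!: continuous_intros)
  have bd: "\<bar>profile \<eta> a b (p - R)\<bar> \<le> 2 * s" for p
  proof -
    have "2 * s * (1 / (1 + (p - R)\<^sup>2)) \<le> 2 * s * 1"
      using s by (intro mult_left_mono) (auto simp: add_pos_nonneg)
    then show ?thesis using abs_profile_le[of \<eta> a b "p - R"] by (simp add: s_def)
  qed
  note * = in_space_if_DERIV[OF der cont shift[OF integrable_profile] shift[OF int'] bd, of B]
  show "in_space B (\<lambda>p. profile \<eta> a b (p - R))" by (rule *(1))
  have "(LINT p|lborel. \<bar>profile \<eta> a b p\<bar>) \<le> (LINT p|lborel. 2 * s * (1 / (1 + p\<^sup>2)))"
    using abs_profile_le[of \<eta> a b]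
    by (intro integral_mono integrable_abs integrable_profile integrable_mult_right
        integrable_inverse_one_plus_square) (simp add: s_def)
  also have "\<dots> = 2 * s * pi"
    by (subst integral_mult_right_zero) (simp only: integral_inverse_one_plus_square)
  finally have 1: "(LINT p|lborel. \<bar>profile \<eta> a b p\<bar>) \<le> 2 * s * pi" .
  have "(LINT p|lborel. \<bar>profile_deriv \<eta> a b p\<bar>) \<le> (LINT p|lborel. ?w p)"
    using abs_profile_deriv_le[OF \<eta>, of a b]
    by (intro integral_mono integrable_abs int' w) (simp add: s_def)
  also have "\<dots> = \<bar>a\<bar> * pi + 2 * s * pi"
    by (subst Bochner_Integration.integral_add)
       (simp_all only: integral_mult_right_zero integral_inverse_one_plus_square
         integral_inverse_one_plus_square_scaled[OF \<eta>] integrable_mult_right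
         integrable_inverse_one_plus_square integrable_inverse_one_plus_square_scaled[OF \<eta>])
  finally have 2: "(LINT p|lborel. \<bar>profile_deriv \<eta> a b p\<bar>) \<le> \<bar>a\<bar> * pi + 2 * s * pi" .
  have 3: "\<bar>a\<bar> * pi \<le> s * pi" "s * pi \<le> s * 4"
    using s pi_less_4 by (auto intro!: mult_right_mono mult_left_mono)
  \<comment> \<open>The contributions are \<open>2 * s * pi\<close> from the function, at most
    \<open>3 * s * pi\<close> from its derivative and \<open>2 * s\<close> from the supremum;
    \<open>pi < 4\<close> gives 22.\<close>
  have "space_norm B (\<lambda>p. profile \<eta> a b (p - R)) \<le> 22 * s"
    using *(2) 1 2 3 shift_eq[of "\<lambda>p. \<bar>profile \<eta> a b p\<bar>"] shift_eq[of "\<lambda>p. \<bar>profile_deriv \<eta> a b p\<bar>"]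
    by linarith
  then show "space_norm B (\<lambda>p. profile \<eta> a b (p - R)) \<le> 22 * (\<bar>a\<bar> + \<bar>b\<bar>)"
    by (simp only: s_def)
qed

text \<open>Reflection turns the integral into its own negative. This removes the terms of mixed
  parity from the Cauchy integral.\<close>

lemma integral_odd_eq_0:
  fixes f :: "real \<Rightarrow> real"
  assumes "\<And>x. f (- x) = - f x"
  shows "(LINT x|lborel. f x) = 0"
  using lborel_integral_real_affine[of "-1" f 0] by (simp add: assms)

section \<open>Cauchy integrals\<close>

text \<open>Up to sign, \<open>odd_response\<close> is the Cauchy integral at
  \<open>i \<eta>\<close> of the profile with \<open>a = 1\<close>, \<open>b = 0\<close>, and
  \<open>even_response\<close> is the imaginary part of that with \<open>a = 0\<close>,
  \<open>b = 1\<close>.\<close>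

definition odd_response :: "real \<Rightarrow> real" where
  "odd_response \<eta> = (LINT q|lborel. arctan (q / \<eta>) * (q / (q\<^sup>2 + \<eta>\<^sup>2)) / (1 + q\<^sup>2))"

definition even_response :: "real \<Rightarrow> real" where
  "even_response \<eta> = (LINT q|lborel. \<eta> / (q\<^sup>2 + \<eta>\<^sup>2) / (1 + q\<^sup>2))"

text \<open>Up to sign the quotients are the real and imaginary parts of
  \<open>1 / (i \<eta> - q)\<close>, whose pole lies at distance \<open>\<eta>\<close> from the real
  line.\<close>

lemma kernel_bounds:
  fixes q \<eta> :: real
  assumes "0 < \<eta>"
  shows "\<bar>q / (q\<^sup>2 + \<eta>\<^sup>2)\<bar> \<le> 1 / \<eta>" and "\<bar>\<eta> / (q\<^sup>2 + \<eta>\<^sup>2)\<bar> \<le> 1 / \<eta>"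
proof -
  have pos: "0 < q\<^sup>2 + \<eta>\<^sup>2" using assms by (simp add: add_nonneg_pos)
  have "0 \<le> (\<bar>q\<bar> - \<eta>)\<^sup>2" "0 \<le> \<bar>q\<bar> * \<eta>" using assms by auto
  then have "\<bar>q\<bar> * \<eta> \<le> q\<^sup>2 + \<eta>\<^sup>2"
    by (simp add: power2_diff)
  then show "\<bar>q / (q\<^sup>2 + \<eta>\<^sup>2)\<bar> \<le> 1 / \<eta>"
    using pos assms by (simp add: field_simps)
  show "\<bar>\<eta> / (q\<^sup>2 + \<eta>\<^sup>2)\<bar> \<le> 1 / \<eta>"
    using pos assms by (simp add: field_simps power2_eq_square)
qed

lemma integrable_responses:
  assumes "0 < \<eta>"
  shows "integrable lborel (\<lambda>q. arctan (q / \<eta>) * (q / (q\<^sup>2 + \<eta>\<^sup>2)) / (1 + q\<^sup>2))"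
    and "integrable lborel (\<lambda>q. q / (q\<^sup>2 + \<eta>\<^sup>2) / (1 + q\<^sup>2))"
    and "integrable lborel (\<lambda>q. arctan (q / \<eta>) * (\<eta> / (q\<^sup>2 + \<eta>\<^sup>2)) / (1 + q\<^sup>2))"
    and "integrable lborel (\<lambda>q. \<eta> / (q\<^sup>2 + \<eta>\<^sup>2) / (1 + q\<^sup>2))"
proof -
  have "\<bar>arctan x * y\<bar> \<le> 2 * (1 / \<eta>)" if "\<bar>y\<bar> \<le> 1 / \<eta>" for x y
    unfolding abs_mult using that abs_arctan_le_2[of x] by (intro mult_mono) auto
  note b = this[OF kernel_bounds(1)[OF assms]] this[OF kernel_bounds(2)[OF assms]]
  show "integrable lborel (\<lambda>q. arctan (q / \<eta>) * (q / (q\<^sup>2 + \<eta>\<^sup>2)) / (1 + q\<^sup>2))"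
    by (rule integrable_bounded_over_one_plus_square[OF _ b(1)]) measurable
  show "integrable lborel (\<lambda>q. arctan (q / \<eta>) * (\<eta> / (q\<^sup>2 + \<eta>\<^sup>2)) / (1 + q\<^sup>2))"
    by (rule integrable_bounded_over_one_plus_square[OF _ b(2)]) measurable
  show "integrable lborel (\<lambda>q. q / (q\<^sup>2 + \<eta>\<^sup>2) / (1 + q\<^sup>2))"
    by (rule integrable_bounded_over_one_plus_square[OF _ kernel_bounds(1)[OF assms]]) measurable
  show "integrable lborel (\<lambda>q. \<eta> / (q\<^sup>2 + \<eta>\<^sup>2) / (1 + q\<^sup>2))"
    by (rule integrable_bounded_over_one_plus_square[OF _ kernel_bounds(2)[OF assms]]) measurable
qed

text \<open>The real part of the kernel is odd and the imaginary part even, so the odd arctan term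
  survives only in the real part and the even term only in the imaginary part. Hence
  \<open>a\<close> and \<open>b\<close> can be solved for separately.\<close>

lemma cauchy_integral_profile:
  assumes \<eta>: "0 < \<eta>"
  shows "(LINT q|lborel. complex_of_real (profile \<eta> a b q) / (Complex 0 \<eta> - complex_of_real q))
    = - Complex (a * odd_response \<eta>) (b * even_response \<eta>)"
proof -
  let ?X = "\<lambda>q. a * (arctan (q / \<eta>) * (q / (q\<^sup>2 + \<eta>\<^sup>2)) / (1 + q\<^sup>2)) + b * (q / (q\<^sup>2 + \<eta>\<^sup>2) / (1 + q\<^sup>2))"
  let ?Y = "\<lambda>q. a * (arctan (q / \<eta>) * (\<eta> / (q\<^sup>2 + \<eta>\<^sup>2)) / (1 + q\<^sup>2)) + b * (\<eta> / (q\<^sup>2 + \<eta>\<^sup>2) / (1 + q\<^sup>2))"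
  have iX: "integrable lborel ?X" and iY: "integrable lborel ?Y"
    by (intro Bochner_Integration.integrable_add integrable_mult_right integrable_responses[OF \<eta>])+
  have X: "(LINT q|lborel. ?X q) = a * odd_response \<eta>"
    by (subst Bochner_Integration.integral_add)
       (simp_all only: integrable_mult_right integrable_responses[OF \<eta>] integral_mult_right_zero
         odd_response_def, simp add: integral_odd_eq_0)
  have Y: "(LINT q|lborel. ?Y q) = b * even_response \<eta>"
    by (subst Bochner_Integration.integral_add)
       (simp_all only: integrable_mult_right integrable_responses[OF \<eta>] integral_mult_right_zero
         even_response_def, simp add: integral_odd_eq_0 arctan_minus)
  have "complex_of_real (profile \<eta> a b q) / (Complex 0 \<eta> - complex_of_real q)
      = - (complex_of_real (?X q) + \<i> * complex_of_real (?Y q))" for q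
  proof -
    have split: "profile \<eta> a b q * c =
        a * (arctan (q / \<eta>) * c / (1 + q\<^sup>2)) + b * (c / (1 + q\<^sup>2))" for c
      unfolding profile_def by (simp add: add_divide_distrib distrib_right)
    have pos: "q\<^sup>2 + \<eta>\<^sup>2 \<noteq> 0" using \<eta> by (simp add: add_nonneg_eq_0_iff)
    have k: "1 / (Complex 0 \<eta> - complex_of_real q) = - Complex (q / (q\<^sup>2 + \<eta>\<^sup>2)) (\<eta> / (q\<^sup>2 + \<eta>\<^sup>2))"
      using pos by (simp add: complex_eq_iff Re_divide Im_divide)
    have "complex_of_real (profile \<eta> a b q) / (Complex 0 \<eta> - complex_of_real q)
      = complex_of_real (profile \<eta> a b q) * (1 / (Complex 0 \<eta> - complex_of_real q))" by simp
    also have "\<dots> = - Complex (profile \<eta> a b q * (q / (q\<^sup>2 + \<eta>\<^sup>2))) (profile \<eta> a b q * (\<eta> / (q\<^sup>2 + \<eta>\<^sup>2)))"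
      unfolding k by (simp add: complex_eq_iff)
    also have "profile \<eta> a b q * (q / (q\<^sup>2 + \<eta>\<^sup>2)) = ?X q"
      by (rule split)
    also have "profile \<eta> a b q * (\<eta> / (q\<^sup>2 + \<eta>\<^sup>2)) = ?Y q"
      by (rule split)
    finally show ?thesis by (simp add: complex_eq_iff)
  qed
  then have "(LINT q|lborel. complex_of_real (profile \<eta> a b q) / (Complex 0 \<eta> - complex_of_real q))
      = (LINT q|lborel. - (complex_of_real (?X q) + \<i> * complex_of_real (?Y q)))"
    by (simp only:)
  also have "\<dots> = - (LINT q|lborel. complex_of_real (?X q) + \<i> * complex_of_real (?Y q))"
    by (rule Bochner_Integration.integral_minus)
  also have "(LINT q|lborel. complex_of_real (?X q) + \<i> * complex_of_real (?Y q))
      = (LINT q|lborel. complex_of_real (?X q)) + (LINT q|lborel. \<i> * complex_of_real (?Y q))"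
    by (rule Bochner_Integration.integral_add[OF integrable_of_real[OF iX]
          integrable_mult_right[OF integrable_of_real[OF iY]]])
  also have "\<dots> = complex_of_real (a * odd_response \<eta>) + \<i> * complex_of_real (b * even_response \<eta>)"
    by (simp only: integral_mult_right_zero integral_complex_of_real X Y)
  finally show ?thesis by (simp add: complex_eq_iff)
qed

text \<open>On \<open>{\<eta>..1}\<close> the arctan is at least \<open>1 / 2\<close>, the kernel at
  least \<open>1 / (2 * q)\<close> and the weight at least \<open>1 / 2\<close>, so the integrand
  dominates \<open>1 / (8 * q)\<close>. Elsewhere it is nonnegative, since
  \<open>arctan (q / \<eta>)\<close> has the sign of \<open>q\<close>.\<close>

lemma odd_response_ge:
  assumes \<eta>: "0 < \<eta>" "\<eta> < 1"
  shows "- ln \<eta> / 8 \<le> odd_response \<eta>"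
proof -
  have FTC: "has_bochner_integral lborel (\<lambda>x. 1 / (8 * x) * indicator {\<eta>..1} x) (ln 1 / 8 - ln \<eta> / 8)"
    by (rule has_bochner_integral_FTC_Icc_real[where F="\<lambda>x. ln x / 8"])
       (use \<eta> in \<open>auto intro!: derivative_eq_intros continuous_intros\<close>)
  have le: "1 / (8 * q) * indicator {\<eta>..1} q \<le> arctan (q / \<eta>) * (q / (q\<^sup>2 + \<eta>\<^sup>2)) / (1 + q\<^sup>2)" for q
  proof (cases "q \<in> {\<eta>..1}")
    case True
    then have q: "0 < q" "\<eta> \<le> q" "q \<le> 1" using \<eta> by auto
    have "arctan 1 \<le> arctan (q / \<eta>)" unfolding arctan_le_iff using q \<eta> by simp
    then have A: "1 / 2 \<le> arctan (q / \<eta>)" using pi_ge_two by (simp add: arctan_one)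
    have "\<eta>\<^sup>2 \<le> q\<^sup>2" using q \<eta> by (intro power_mono) auto
    then have "q / (2 * q\<^sup>2) \<le> q / (q\<^sup>2 + \<eta>\<^sup>2)"
      using q \<eta> by (intro divide_left_mono mult_pos_pos add_pos_pos) auto
    then have Bq: "1 / (2 * q) \<le> q / (q\<^sup>2 + \<eta>\<^sup>2)" using q by (simp add: power2_eq_square)
    have q2: "q\<^sup>2 \<le> 1" using q by (simp add: power_le_one)
    have "1 / 2 * (1 / (2 * q)) \<le> arctan (q / \<eta>) * (q / (q\<^sup>2 + \<eta>\<^sup>2))"
      using A Bq q \<eta> by (intro mult_mono) auto
    then have "1 / 2 * (1 / (2 * q)) / 2 \<le> arctan (q / \<eta>) * (q / (q\<^sup>2 + \<eta>\<^sup>2)) / 2"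
      by (rule divide_right_mono) simp
    also have "\<dots> \<le> arctan (q / \<eta>) * (q / (q\<^sup>2 + \<eta>\<^sup>2)) / (1 + q\<^sup>2)"
      using A q q2 \<eta> by (intro divide_left_mono mult_nonneg_nonneg) (auto simp: add_pos_nonneg)
    finally have "1 / 2 * (1 / (2 * q)) / 2 \<le> arctan (q / \<eta>) * (q / (q\<^sup>2 + \<eta>\<^sup>2)) / (1 + q\<^sup>2)" .
    then show ?thesis using True by simp
  next
    case False
    have "0 \<le> arctan (q / \<eta>) * q"
      using \<eta> by (cases "0 \<le> q") (auto simp: zero_le_mult_iff divide_le_0_iff)
    then have "0 \<le> arctan (q / \<eta>) * q / (q\<^sup>2 + \<eta>\<^sup>2) / (1 + q\<^sup>2)" by simp
    then show ?thesis using False by simp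
  qed
  have "(LINT x|lborel. 1 / (8 * x) * indicator {\<eta>..1} x) \<le> odd_response \<eta>"
    unfolding odd_response_def using FTC le
    by (intro integral_mono integrable_responses(1)[OF \<eta>(1)]) (auto simp: has_bochner_integral_iff)
  then show ?thesis using FTC by (simp add: has_bochner_integral_iff)
qed

lemma even_response_pos:
  assumes \<eta>: "0 < \<eta>"
  shows "0 < even_response \<eta>"
proof -
  \<comment> \<open>The value of the integrand at \<open>q = 1\<close>, which is its minimum on
    \<open>{0..1}\<close>.\<close>
  define c where "c = \<eta> / (1 + \<eta>\<^sup>2) / 2"
  have le: "c * indicator {0..1::real} q \<le> \<eta> / (q\<^sup>2 + \<eta>\<^sup>2) / (1 + q\<^sup>2)" for q
  proof (cases "q \<in> {0..1}")
    case True
    then have "q\<^sup>2 \<le> 1" by (simp add: power_le_one)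
    then have "c \<le> \<eta> / (q\<^sup>2 + \<eta>\<^sup>2) / (1 + q\<^sup>2)"
      unfolding c_def using \<eta> by (intro frac_le) (auto simp: add_pos_nonneg add_nonneg_pos)
    then show ?thesis using True by simp
  qed (use \<eta> in auto)
  have FTC: "has_bochner_integral lborel (\<lambda>q. c * indicator {0..1::real} q) (c * 1 - c * 0)"
    by (rule has_bochner_integral_FTC_Icc_real[where F="\<lambda>q. c * q"])
       (auto intro!: derivative_eq_intros)
  have "0 < c" using \<eta> by (simp add: c_def add_pos_pos)
  also have "c = (LINT q|lborel. c * indicator {0..1::real} q)"
    using FTC by (simp add: has_bochner_integral_iff)
  also have "\<dots> \<le> even_response \<eta>"
    unfolding even_response_def using FTC
    by (intro integral_mono le integrable_responses(4)[OF \<eta>]) (simp add: has_bochner_integral_iff)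
  finally show ?thesis .
qed

section \<open>Cauchy integrals of general integrable functions\<close>

lemma norm_cauchy_kernel_le:
  assumes "0 < Im u"
  shows "norm (complex_of_real x / (u - complex_of_real p)) \<le> \<bar>x\<bar> / Im u"
proof -
  have "Im u \<le> norm (u - complex_of_real p)" using abs_Im_le_cmod[of "u - complex_of_real p"] by simp
  then show ?thesis
    unfolding norm_divide using assms by (simp, intro divide_left_mono) (auto intro!: mult_pos_pos)
qed

lemma integrable_cauchy_kernel:
  fixes f :: "real \<Rightarrow> real"
  assumes "integrable lborel f" and "0 < Im u"
  shows "integrable lborel (\<lambda>p. complex_of_real (f p) / (u - complex_of_real p))"
proof (rule Bochner_Integration.integrable_bound)
  show "integrable lborel (\<lambda>p. f p / Im u)" using assms(1) by simp
  show "AE p in lborel. norm (complex_of_real (f p) / (u - complex_of_real p)) \<le> norm (f p / Im u)"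
    using norm_cauchy_kernel_le[OF assms(2)] assms(2) by simp
qed (use assms(1) in measurable)

text \<open>Moving the pole horizontally keeps its distance to the real line at least
  \<open>\<eta>\<close>, so \<open>\<bar>f p\<bar> / \<eta>\<close> dominates throughout while the
  kernel tends to zero pointwise.\<close>

lemma cauchy_integral_tendsto_0:
  fixes f :: "real \<Rightarrow> real"
  assumes f: "integrable lborel f" and \<eta>: "0 < \<eta>"
  shows "(\<lambda>n. LINT p|lborel. complex_of_real (f p) / (Complex (real n) \<eta> - complex_of_real p)) \<longlonglongrightarrow> 0"
proof -
  have [measurable]: "f \<in> borel_measurable borel" using f by auto
  have "(\<lambda>n. complex_of_real (f p) / (Complex (real n) \<eta> - complex_of_real p)) \<longlonglongrightarrow> 0" for p
  proof (rule tendsto_divide_0[OF tendsto_const])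
    show "filterlim (\<lambda>n. Complex (real n) \<eta> - complex_of_real p) at_infinity sequentially"
    proof (rule filterlim_norm_at_top_imp_at_infinity, rule filterlim_at_top_mono)
      show "filterlim (\<lambda>n. real n - p) at_top sequentially" by real_asymp
      show "\<forall>\<^sub>F n in sequentially. real n - p \<le> norm (Complex (real n) \<eta> - complex_of_real p)"
        using complex_Re_le_cmod[of "Complex (real _) \<eta> - complex_of_real p"] by (intro always_eventually) simp
    qed
  qed
  note lim = this
  have "norm (complex_of_real (f p) / (Complex (real n) \<eta> - complex_of_real p)) \<le> \<bar>f p\<bar> / \<eta>" for n p
    using norm_cauchy_kernel_le[of "Complex (real n) \<eta>"] \<eta> by simp
  note bound = this
  have "(\<lambda>n. LINT p|lborel. complex_of_real (f p) / (Complex (real n) \<eta> - complex_of_real p))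
      \<longlonglongrightarrow> integral\<^sup>L lborel (\<lambda>_::real. 0)"
  proof (rule integral_dominated_convergence[where w="\<lambda>p. \<bar>f p\<bar> / \<eta>"])
    show "integrable lborel (\<lambda>p. \<bar>f p\<bar> / \<eta>)" using f by simp
  qed (use lim bound in \<open>auto intro!: AE_I2\<close>)
  then show ?thesis by simp
qed

section \<open>Choice of the parameters and the unstable root\<close>

theorem theorem1:
  fixes B :: space and K :: "real set" and f0 f0' :: "real \<Rightarrow> real"
  assumes "K \<noteq> {}" and "0 \<notin> K"
    and "\<forall>p. (f0 has_real_derivative f0' p) (at p)"
    and "in_space B f0'"
    and "spectrally_stable K f0'"
  shows "\<forall>\<epsilon>>0. \<exists>\<delta>f0 \<delta>f0' :: real \<Rightarrow> real.
           (\<forall>p. (\<delta>f0 has_real_derivative \<delta>f0' p) (at p)) \<and>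
           in_space B \<delta>f0' \<and> space_norm B \<delta>f0' < \<epsilon> \<and>
           (\<forall>p. ((\<lambda>q. f0 q + \<delta>f0 q) has_real_derivative (f0' p + \<delta>f0' p)) (at p)) \<and>
           \<not> spectrally_stable K (\<lambda>p. f0' p + \<delta>f0' p)"
proof (intro allI impI)
  fix \<epsilon> :: real assume \<epsilon>: "0 < \<epsilon>"
  obtain k where k: "k \<in> K" "k \<noteq> 0" using assms(1,2) by blast
  have f0': "integrable lborel f0'" using assms(4) by (cases B) auto

  \<comment> \<open>The budget \<open>\<epsilon>\<close> is shared equally by \<open>a\<close> and
    \<open>b\<close> under the norm constant 22, hence 44. The choice makes
    \<open>(k\<^sup>2 + 1) / A < \<epsilon> / 44\<close>, strictly because of the final 1.\<close>
  define A where "A = 44 * (k\<^sup>2 + 1) / \<epsilon> + 1"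
  have A: "0 < A" using \<epsilon> by (simp add: A_def add_nonneg_pos)
  \<comment> \<open>For this value the lower bound \<open>- ln \<eta> / 8\<close> on
    \<open>odd_response \<eta>\<close> is exactly \<open>A\<close>.\<close>
  define \<eta> where "\<eta> = exp (- (8 * A))"
  have \<eta>: "0 < \<eta>" "\<eta> < 1" using A by (auto simp: \<eta>_def)
  define J where "J = odd_response \<eta>"
  define E where "E = even_response \<eta>"
  have "A \<le> J" using odd_response_ge[OF \<eta>] by (simp add: J_def \<eta>_def)
  with A have J: "0 < J" by linarith
  have E: "0 < E" unfolding E_def by (rule even_response_pos[OF \<eta>(1)])

  define h where "h n = (LINT p|lborel. complex_of_real (f0' p) / (Complex (real n) \<eta> - complex_of_real p))" for n
  have "h \<longlonglongrightarrow> 0" unfolding h_def by (rule cauchy_integral_tendsto_0[OF f0' \<eta>(1)])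
  \<comment> \<open>The bound 1 controls the numerator of \<open>a\<close>, the other one controls
    \<open>b\<close>. As \<open>E\<close> depends only on \<open>\<eta>\<close>, it is fixed before
    \<open>n\<close> is chosen.\<close>
  moreover have "0 < min 1 (\<epsilon> * E / 44)" using \<epsilon> E by simp
  ultimately have "\<exists>N. \<forall>n\<ge>N. norm (h n - 0) < min 1 (\<epsilon> * E / 44)"
    by (rule LIMSEQ_D)
  then obtain n where n: "norm (h n) < min 1 (\<epsilon> * E / 44)"
    by auto
  \<comment> \<open>These solve \<open>a * J = k\<^sup>2 + Re (h n)\<close> and
    \<open>b * E = Im (h n)\<close>, so the perturbed Cauchy integral at \<open>u\<close> is exactly
    \<open>- k\<^sup>2\<close>.\<close>
  define a where "a = (k\<^sup>2 + Re (h n)) / J"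
  define b where "b = Im (h n) / E"
  define u where "u = Complex (real n) \<eta>"
  define \<delta> where "\<delta> p = profile \<eta> a b (p - real n)" for p
  have a: "\<bar>a\<bar> < \<epsilon> / 44"
  proof -
    have "\<bar>k\<^sup>2 + Re (h n)\<bar> \<le> k\<^sup>2 + 1"
      using n abs_Re_le_cmod[of "h n"] zero_le_power2[of k] by linarith
    also have "\<dots> < \<epsilon> / 44 * A" using \<epsilon> by (simp add: A_def field_simps)
    also have "\<dots> \<le> \<epsilon> / 44 * J" using \<epsilon> \<open>A \<le> J\<close> by (intro mult_left_mono) auto
    finally show ?thesis using J by (simp add: a_def field_simps)
  qed
  have b: "\<bar>b\<bar> < \<epsilon> / 44"
  proof -
    have "\<bar>Im (h n)\<bar> < \<epsilon> * E / 44" using n abs_Im_le_cmod[of "h n"] by linarith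
    then show ?thesis using E by (simp add: b_def field_simps)
  qed
  have \<delta>: "in_space B \<delta>" "space_norm B \<delta> < \<epsilon>"
    using profile_in_space[OF \<eta>(1), of B a b "real n"] a b unfolding \<delta>_def by auto
  have \<delta>_int: "integrable lborel \<delta>"
    using \<delta>(1) by (cases B) auto
  \<comment> \<open>The profile prescribes the derivative of the perturbation; its continuity
    supplies an antiderivative on the whole line to serve as \<open>\<delta>f0\<close>.\<close>
  have "\<exists>F. \<forall>x::real. - \<infinity> < ereal x \<longrightarrow> ereal x < \<infinity> \<longrightarrow> (F has_vector_derivative \<delta> x) (at x)"
  proof (rule einterval_antiderivative)
    show "isCont \<delta> x" for x
      unfolding \<delta>_def profile_def using one_plus_square_neq_0[of "x - real n"] \<eta>
      by (intro continuous_intros) auto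
  qed simp
  then obtain F where F: "\<And>x. (F has_real_derivative \<delta> x) (at x)"
    by (auto simp: has_real_derivative_iff_has_vector_derivative)

  have u: "0 < Im u" using \<eta> by (simp add: u_def)
  \<comment> \<open>Translation by \<open>n\<close> recentres the profile at the origin and moves
    the pole to \<open>i \<eta>\<close>.\<close>
  have "(LINT p|lborel. complex_of_real (\<delta> p) / (u - complex_of_real p))
      = (LINT q|lborel. complex_of_real (profile \<eta> a b q) / (Complex 0 \<eta> - complex_of_real q))"
  proof -
    have "u - complex_of_real (real n + q) = Complex 0 \<eta> - complex_of_real q" for q
      by (simp add: u_def complex_eq_iff)
    then show ?thesis
      using lborel_integral_real_affine[of 1 "\<lambda>p. complex_of_real (\<delta> p) / (u - complex_of_real p)" "real n"]
      by (simp add: \<delta>_def del: of_real_add)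
  qed
  also have "\<dots> = - Complex (a * J) (b * E)"
    unfolding J_def E_def by (rule cauchy_integral_profile[OF \<eta>(1)])
  also have "\<dots> = - complex_of_real (k\<^sup>2) - h n"
    using J E by (simp add: a_def b_def complex_eq_iff)
  finally have cauchy: "(LINT p|lborel. complex_of_real (\<delta> p) / (u - complex_of_real p))
    = - complex_of_real (k\<^sup>2) - h n" .
  have "(LINT p|lborel. complex_of_real (f0' p + \<delta> p) / (u - complex_of_real p))
      = h n + (LINT p|lborel. complex_of_real (\<delta> p) / (u - complex_of_real p))"
    unfolding h_def u_def[symmetric]
    by (subst Bochner_Integration.integral_add[symmetric])
       (auto simp: add_divide_distrib intro!: integrable_cauchy_kernel f0' \<delta>_int u)
  \<comment> \<open>The two occurrences of \<open>h n\<close> cancel, leaving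
    \<open>1 - k\<^sup>2 / k\<^sup>2\<close>, which is zero as \<open>k\<close> is nonzero.\<close>
  then have "dispersion (\<lambda>p. f0' p + \<delta> p) k u = 0"
    using k unfolding dispersion_def cauchy by simp
  then have "\<not> spectrally_stable K (\<lambda>p. f0' p + \<delta> p)"
    using k u by (auto simp: spectrally_stable_def)
  then show "\<exists>\<delta>f0 \<delta>f0' :: real \<Rightarrow> real.
           (\<forall>p. (\<delta>f0 has_real_derivative \<delta>f0' p) (at p)) \<and>
           in_space B \<delta>f0' \<and> space_norm B \<delta>f0' < \<epsilon> \<and>
           (\<forall>p. ((\<lambda>q. f0 q + \<delta>f0 q) has_real_derivative (f0' p + \<delta>f0' p)) (at p)) \<and>
           \<not> spectrally_stable K (\<lambda>p. f0' p + \<delta>f0' p)"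
    using F \<delta> assms(3) by (intro exI[of _ F] exI[of _ \<delta>]) (auto intro: DERIV_add)
qed

end
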